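(* Let $m\ge2$, $n=2^m-1$, and let $\mathcal H_m\subset\{0,1\}^n$ be the binary Hamming code. Then $$D^{L_2}(\mathcal H_m)=\frac{n}{2^n}\binom{n-1}{\frac{n-1}2},$$ and for large $n$, $D^{L_2}(\mathcal H_m)=\sqrt{n/(2\pi)}\,(1-o(1))$.
   Context: The binary Hamming code of length $n=2^m-1$ is $\{x\in\mathbb F_2^n: Hx^T=0\}$, where $H$ is the $m\times n$ binary matrix whose columns are all the nonzero vectors of $\mathbb F_2^m$; it has $N=2^{n-m}$ elements. For $Z=\{z_1,\dots,z_N\}\subset\{0,1\}^n$ with Hamming distance $d$ and $B(x,t)=\{y:d(x,y)\le t\}$, $D^{L_2}(Z)=\sum_{t=0}^n\sum_{x}\Big(\frac1N\sum_{j=1}^N\mathbb 1_{B(x,t)}(z_j)-\frac{|B(x,t)|}{2^n}\Big)^2$. *)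

theory Defs
  imports
    "Jordan_Normal_Form.Matrix_Kernel"
    "HOL-Library.Indicator_Function"
    "HOL-Library.Z2"
    "HOL-Library.Landau_Symbols"
begin

text \<open>Binary words of length \<open>n\<close> are the elements of \<open>carrier_vec n :: bit vec set\<close>.\<close>

definition hamming_dist :: "bit vec \<Rightarrow> bit vec \<Rightarrow> nat" where
  "hamming_dist x y = card {i. i < dim_vec x \<and> x $ i \<noteq> y $ i}"

definition hamming_ball :: "nat \<Rightarrow> bit vec \<Rightarrow> nat \<Rightarrow> bit vec set" where
  "hamming_ball n x t = {y \<in> carrier_vec n. hamming_dist x y \<le> t}"

definition L2_discrepancy :: "nat \<Rightarrow> bit vec set \<Rightarrow> real" where
  "L2_discrepancy n Z =
     (\<Sum>t = 0..n. \<Sum>x \<in> carrier_vec n.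
        (1 / real (card Z) * (\<Sum>z \<in> Z. indicator (hamming_ball n x t) z)
           - real (card (hamming_ball n x t)) / 2 ^ n)\<^sup>2)"

text \<open>
  As there are exactly \<open>2 ^ m - 1\<close> nonzero vectors of length \<open>m\<close>, the number of columns
  forces each of them to occur exactly once. Their order is left arbitrary, so a Hamming
  code is determined by \<open>m\<close> only up to a permutation of the coordinates.
\<close>

definition hamming_parity_check :: "nat \<Rightarrow> bit mat \<Rightarrow> bool" where
  "hamming_parity_check m H \<longleftrightarrow>
     H \<in> carrier_mat m (2 ^ m - 1) \<and> set (cols H) = carrier_vec m - {0\<^sub>v m}"

definition is_hamming_code :: "nat \<Rightarrow> bit vec set \<Rightarrow> bool" where
  "is_hamming_code m C \<longleftrightarrow> (\<exists>H. hamming_parity_check m H \<and> C = mat_kernel H)"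

end

theory Submission
  imports "HOL-Analysis.Gamma_Function" Defs
begin

text \<open>
  The indicator function of the code \<open>ker H\<close> is the average of the characters
  \<open>y \<mapsto> (-1)\<^bsup>(H\<^sup>T v) \<bullet> y\<^esup>\<close>. Each nonzero row combination \<open>H\<^sup>T v\<close> has weight \<open>(n + 1) / 2\<close>, so with
  \<open>n = 2 k + 1\<close> the sum of its character over a ball of radius \<open>t\<close> about the origin is the
  coefficient \<open>c t\<close> of \<open>z ^ t\<close> in \<open>(1 - z\<^sup>2) ^ k\<close>, whatever \<open>v\<close> is. Hence the local discrepancy at
  \<open>(x, t)\<close> is \<open>c t / 2 ^ n\<close> times \<open>2 ^ m - 1\<close> for codewords \<open>x\<close> and times \<open>-1\<close> for all other \<open>x\<close>.
  Summing squares over \<open>x\<close> gives \<open>n / 2 ^ n\<close> times \<open>(c t)\<^sup>2\<close>, and summing over \<open>t\<close> gives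
  \<open>\<Sum>j. (k choose j)\<^sup>2 = (2 k choose k)\<close>. The asymptotics are exact in terms of the
  partial Wallis products \<open>W k\<close>: the discrepancy equals \<open>sqrt (n / W k) / 2\<close>.
\<close>

unbundle no inner_syntax and no vec_syntax

text \<open>These rules rewrite field operations on \<open>bit\<close> to bitwise operations, which hides them
  from the ring lemmas.\<close>
declare add_bit_eq_xor [simp del] mult_bit_eq_and [simp del]

section \<open>Characters of binary vector spaces\<close>

text \<open>The nontrivial character of the additive group of F_2, that is, (-1)^b.\<close>

definition bit_sign :: "bit \<Rightarrow> real" where
  "bit_sign b = (if b = 0 then 1 else - 1)"

definition hamming_weight :: "bit vec \<Rightarrow> nat" where
  "hamming_weight e = card {i. i < dim_vec e \<and> e $ i \<noteq> 0}"

text \<open>Identifying words with their supports turns sums over words into sums over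
  \<open>Pow {..<n}\<close>, the shape in which a product of binomials expands.\<close>

definition indicator_vec :: "nat \<Rightarrow> nat set \<Rightarrow> bit vec" where
  "indicator_vec n E = vec n (\<lambda>i. of_bool (i \<in> E))"

lemma bit_add_self [simp]: "(b::bit) + b = 0"
  by (cases b) simp_all

lemma bit_sign_0 [simp]: "bit_sign 0 = 1" and bit_sign_1 [simp]: "bit_sign 1 = -1"
  by (simp_all add: bit_sign_def)

lemma bit_sign_add: "bit_sign (a + b) = bit_sign a * bit_sign b"
  by (cases a; cases b) simp_all

lemma bit_sign_sum: "bit_sign (sum f A) = (\<Prod>i\<in>A. bit_sign (f i))"
  by (induction A rule: infinite_finite_induct) (simp_all add: bit_sign_add)

lemma bij_betw_indicator_vec: "bij_betw (indicator_vec n) (Pow {..<n}) (carrier_vec n)"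
proof (rule bij_betw_byWitness[where f' = "\<lambda>e. {i. i < n \<and> e $ i \<noteq> 0}"])
  show "\<forall>E\<in>Pow {..<n}. {i. i < n \<and> indicator_vec n E $ i \<noteq> 0} = E"
    by (auto simp: indicator_vec_def)
  show "\<forall>e\<in>carrier_vec n. indicator_vec n {i. i < n \<and> e $ i \<noteq> 0} = e"
    by (auto simp: indicator_vec_def intro!: eq_vecI)
  show "indicator_vec n ` Pow {..<n} \<subseteq> carrier_vec n"
    by (auto simp: indicator_vec_def)
  show "(\<lambda>e. {i. i < n \<and> e $ i \<noteq> 0}) ` carrier_vec n \<subseteq> Pow {..<n}"
    by auto
qed

lemma finite_carrier_vec_bit [simp]: "finite (carrier_vec n :: bit vec set)"
  using bij_betw_finite[OF bij_betw_indicator_vec[of n]] by simp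

lemma card_carrier_vec_bit: "card (carrier_vec n :: bit vec set) = 2 ^ n"
  using bij_betw_same_card[OF bij_betw_indicator_vec[of n]] by (simp add: card_Pow)

lemma hamming_weight_indicator_vec:
  "E \<subseteq> {..<n} \<Longrightarrow> hamming_weight (indicator_vec n E) = card E"
  unfolding hamming_weight_def indicator_vec_def
  by (rule arg_cong[where f = card]) auto

lemma bit_sign_scalar_indicator_vec:
  assumes "E \<subseteq> {..<n}"
  shows "bit_sign (u \<bullet> indicator_vec n E) = (\<Prod>i\<in>E. bit_sign (u $ i))"
proof -
  have "bit_sign (u \<bullet> indicator_vec n E) = (\<Prod>i<n. if i \<in> E then bit_sign (u $ i) else 1)"
    unfolding scalar_prod_def bit_sign_sum
    by (rule prod.cong) (auto simp: indicator_vec_def)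
  also have "\<dots> = (\<Prod>i\<in>{..<n} \<inter> E. bit_sign (u $ i))"
    by (simp add: prod.inter_restrict)
  finally show ?thesis using assms by (simp add: Int_absorb1)
qed

section \<open>Weight enumerators twisted by a character\<close>

lemma prod_monom_degree_one:
  "finite E \<Longrightarrow> (\<Prod>i\<in>E. monom (f i) 1) = monom (\<Prod>i\<in>E. f i :: real) (card E)"
  by (induction E rule: finite_induct) (simp_all add: mult_monom)

text \<open>A character is multiplicative over coordinates: on expanding the product, choosing the
  linear term exactly at the positions in E yields the term of the word with support E.\<close>

lemma character_weight_enumerator:
  "(\<Sum>e\<in>carrier_vec n. monom (bit_sign (u \<bullet> e)) (hamming_weight e))
     = (\<Prod>i<n. [:1, bit_sign (u $ i):])"
proof -
  have "(\<Sum>e\<in>carrier_vec n. monom (bit_sign (u \<bullet> e)) (hamming_weight e))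
      = (\<Sum>E\<in>Pow {..<n}. monom (bit_sign (u \<bullet> indicator_vec n E))
            (hamming_weight (indicator_vec n E)))"
    by (rule sum.reindex_bij_betw[OF bij_betw_indicator_vec, symmetric])
  \<comment> \<open>The trivial product over the complement of E matches the expansion in
    \<open>prod_add\<close>.\<close>
  also have "\<dots> = (\<Sum>E\<in>Pow {..<n}. (\<Prod>i\<in>E. monom (bit_sign (u $ i)) 1) * (\<Prod>i\<in>{..<n} - E. 1))"
    by (rule sum.cong[OF refl], subst prod_monom_degree_one)
      (auto simp: hamming_weight_indicator_vec bit_sign_scalar_indicator_vec intro: finite_subset)
  also have "\<dots> = (\<Prod>i<n. monom (bit_sign (u $ i)) 1 + 1)"
    by (rule prod_add[symmetric]) simp
  also have "\<dots> = (\<Prod>i<n. [:1, bit_sign (u $ i):])"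
    by (rule prod.cong) (simp_all add: monom_Suc monom_0 one_pCons)
  finally show ?thesis .
qed

text \<open>Orthogonality of characters: at z = 1 the weight enumerator becomes a product of factors
  1 + (-1)^(u_i), which vanishes as soon as some u_i is nonzero.\<close>

lemma character_sum:
  assumes "u \<in> carrier_vec n"
  shows "(\<Sum>e\<in>carrier_vec n. bit_sign (u \<bullet> e)) = (if u = 0\<^sub>v n then 2 ^ n else 0)"
proof -
  have "(\<Sum>e\<in>carrier_vec n. bit_sign (u \<bullet> e)) = (\<Prod>i<n. 1 + bit_sign (u $ i))"
    using arg_cong[OF character_weight_enumerator[where n = n and u = u], of "\<lambda>p. poly p 1"]
    by (simp add: poly_sum poly_prod poly_monom)
  also have "\<dots> = (if u = 0\<^sub>v n then 2 ^ n else 0)"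
  proof (cases "u = 0\<^sub>v n")
    case False
    then obtain i where "i < n" "u $ i \<noteq> 0"
      using assms by (auto simp: vec_eq_iff)
    then have "\<exists>i\<in>{..<n}. 1 + bit_sign (u $ i) = 0"
      by (intro bexI[of _ i]) auto
    then show ?thesis using False by simp
  qed simp
  finally show ?thesis .
qed

lemma character_sum':
  assumes "u \<in> carrier_vec n"
  shows "(\<Sum>e\<in>carrier_vec n. bit_sign (e \<bullet> u)) = (if u = 0\<^sub>v n then 2 ^ n else 0)"
proof -
  have "(\<Sum>e\<in>carrier_vec n. bit_sign (e \<bullet> u)) = (\<Sum>e\<in>carrier_vec n. bit_sign (u \<bullet> e))"
    using assms by (intro sum.cong) (auto simp: comm_scalar_prod)
  then show ?thesis using character_sum[OF assms] by simp
qed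

section \<open>Character sums over Hamming balls\<close>

text \<open>The Fourier coefficient at u of the ball of radius t about the origin.\<close>

definition ball_character_sum :: "nat \<Rightarrow> bit vec \<Rightarrow> nat \<Rightarrow> real" where
  "ball_character_sum n u t =
     (\<Sum>e | e \<in> carrier_vec n \<and> hamming_weight e \<le> t. bit_sign (u \<bullet> e))"

lemma ball_character_sum_eq_coeffs:
  "ball_character_sum n u t = (\<Sum>s\<le>t. coeff (\<Prod>i<n. [:1, bit_sign (u $ i):]) s)"
proof -
  have "(\<Sum>s\<le>t. coeff (\<Prod>i<n. [:1, bit_sign (u $ i):]) s)
      = (\<Sum>e\<in>carrier_vec n. \<Sum>s\<le>t. if hamming_weight e = s then bit_sign (u \<bullet> e) else 0)"
    unfolding character_weight_enumerator[symmetric]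
    by (subst sum.swap) (simp add: coeff_sum)
  also have "\<dots> = (\<Sum>e\<in>carrier_vec n. if hamming_weight e \<le> t then bit_sign (u \<bullet> e) else 0)"
    by (rule sum.cong) auto
  also have "\<dots> = ball_character_sum n u t"
    unfolding ball_character_sum_def by (rule sum.inter_filter[symmetric]) simp
  finally show ?thesis ..
qed

text \<open>For odd \<open>n\<close> and a character with one more sign \<open>-1\<close> than sign \<open>+1\<close>, the weight enumerator
  is \<open>(1 - z) (1 - z\<^sup>2)\<^sup>k\<close>; summing over balls cancels the factor \<open>1 - z\<close>.\<close>
lemma ball_character_sum_balanced:
  assumes "(\<Sum>i<2 * k + 1. bit_sign (u $ i)) = -1"
  shows "ball_character_sum (2 * k + 1) u t = coeff ([:1, 0, -1:] ^ k) t"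
proof -
  define n where "n = 2 * k + 1"
  define A where "A = {i\<in>{..<n}. u $ i = 0}"
  define B where "B = {i\<in>{..<n}. u $ i \<noteq> 0}"
  have AB: "{..<n} = A \<union> B" "A \<inter> B = {}" "finite A" "finite B"
    by (auto simp: A_def B_def)
  have "(\<Sum>i<n. bit_sign (u $ i)) = (\<Sum>i\<in>A. bit_sign (u $ i)) + (\<Sum>i\<in>B. bit_sign (u $ i))"
    unfolding AB(1) by (rule sum.union_disjoint) (use AB in auto)
  also have "\<dots> = (\<Sum>i\<in>A. 1) + (\<Sum>i\<in>B. -1)"
    by (intro arg_cong2[where f = "(+)"] sum.cong) (auto simp: A_def B_def)
  finally have "real (card B) = real (card A) + 1"
    using assms by (simp add: n_def)
  moreover have "card A + card B = n"
    using card_Un_disjoint[OF AB(3,4,2)] AB(1) by (metis card_lessThan)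
  ultimately have cards: "card A = k" "card B = k + 1"
    unfolding n_def by linarith+
  have "(\<Prod>i<n. [:1, bit_sign (u $ i):])
      = (\<Prod>i\<in>A. [:1, bit_sign (u $ i):]) * (\<Prod>i\<in>B. [:1, bit_sign (u $ i):])"
    unfolding AB(1) by (rule prod.union_disjoint) (use AB in auto)
  also have "\<dots> = (\<Prod>i\<in>A. [:1, 1:]) * (\<Prod>i\<in>B. [:1, -1:])"
    by (intro arg_cong2[where f = "(*)"] prod.cong) (auto simp: A_def B_def)
  also have "\<dots> = [:1, -1:] * ([:1, 1:] * [:1, -1:]) ^ k"
    by (simp only: prod_constant cards power_mult_distrib power_add power_one_right mult_ac)
  also have "[:1, 1:] * [:1, -1:] = ([:1, 0, -1:] :: real poly)"
    by simp
  finally have enum: "(\<Prod>i<n. [:1, bit_sign (u $ i):]) = [:1, -1:] * [:1, 0, -1:] ^ k" .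
  have telescope: "(\<Sum>s\<le>t. coeff ([:1, -1:] * q) s) = coeff q t" for q :: "real poly"
    by (induction t) (simp_all add: coeff_pCons)
  show ?thesis
    unfolding ball_character_sum_eq_coeffs n_def[symmetric] enum by (rule telescope)
qed

lemma poly_one_minus_square_power:
  "([:1, 0, -1:] :: real poly) ^ k = (\<Sum>j\<le>k. monom ((-1) ^ j * real (k choose j)) (2 * j))"
proof -
  have "([:1, 0, -1:] :: real poly) ^ k = (monom (-1) 2 + 1) ^ k"
    by (simp add: monom_altdef numeral_2_eq_2 one_pCons)
  also have "\<dots> = (\<Sum>j\<le>k. of_nat (k choose j) * monom (-1) 2 ^ j * 1 ^ (k - j))"
    by (rule binomial_ring)
  also have "\<dots> = (\<Sum>j\<le>k. monom ((-1) ^ j * real (k choose j)) (2 * j))"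
    by (rule sum.cong) (simp_all add: monom_power of_nat_poly smult_monom mult_ac)
  finally show ?thesis .
qed

text \<open>Squaring removes the alternating signs of the binomial coefficients, and Vandermonde's
  identity sums their squares. The range of t is that of the radii 0, ..., n for n = 2k + 1.\<close>

lemma sum_squares_coeff_one_minus_square_power:
  "(\<Sum>t = 0..2 * k + 1. (coeff (([:1, 0, -1:] :: real poly) ^ k) t)\<^sup>2) = real ((2 * k) choose k)"
proof -
  let ?c = "coeff (([:1, 0, -1:] :: real poly) ^ k)"
  have c: "?c t = (if even t \<and> t \<le> 2 * k then (-1) ^ (t div 2) * real (k choose (t div 2)) else 0)" for t
  proof -
    have "?c t = (\<Sum>j\<le>k. if 2 * j = t then (-1) ^ j * real (k choose j) else 0)"
      by (simp add: poly_one_minus_square_power coeff_sum)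
    also have "\<dots> = (\<Sum>j\<in>{j. j \<le> k \<and> 2 * j = t}. (-1) ^ j * real (k choose j))"
      by (subst sum.inter_filter[symmetric]) (auto intro!: sum.cong)
    also have "{j. j \<le> k \<and> 2 * j = t} = (if even t \<and> t \<le> 2 * k then {t div 2} else {})"
      by auto
    finally show ?thesis by simp
  qed
  \<comment> \<open>Odd exponents, among them the last one 2k + 1, have coefficient 0.\<close>
  have "(\<Sum>t = 0..2 * k + 1. (?c t)\<^sup>2) = (\<Sum>t\<in>(\<lambda>j. 2 * j) ` {..k}. (?c t)\<^sup>2)"
    by (rule sum.mono_neutral_right) (auto simp: c elim!: evenE)
  also have "\<dots> = (\<Sum>j\<le>k. (?c (2 * j))\<^sup>2)"
    by (simp add: sum.reindex inj_on_def)
  also have "\<dots> = (\<Sum>j\<le>k. real ((k choose j)\<^sup>2))"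
    by (rule sum.cong) (simp_all add: c power_mult_distrib flip: power_mult)
  also have "\<dots> = real ((2 * k) choose k)"
    by (simp only: choose_square_sum flip: of_nat_sum)
  finally show ?thesis .
qed

section \<open>Linear codes\<close>

lemma sum_indicator_subset:
  assumes "finite B" "A \<subseteq> B"
  shows "(\<Sum>x\<in>B. indicator A x :: real) = real (card A)"
proof -
  have "(\<Sum>x\<in>B. indicator A x :: real) = (\<Sum>x\<in>A. 1)"
    by (rule sum.mono_neutral_cong_right) (use assms in \<open>auto simp: indicator_def\<close>)
  then show ?thesis by simp
qed

text \<open>In characteristic 2 the distance of x and y is the weight of x + y, and translation by x
  is its own inverse.\<close>

lemma hamming_ball_translate:
  assumes "x \<in> carrier_vec n"
  shows "bij_betw (\<lambda>e. x + e) {e \<in> carrier_vec n. hamming_weight e \<le> t} (hamming_ball n x t)"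
proof -
  have inv: "x + (x + e) = e" if "e \<in> carrier_vec n" for e
    using assms that by (intro eq_vecI) (auto simp flip: add.assoc)
  have diff: "a \<noteq> a + b \<longleftrightarrow> b \<noteq> 0" for a b :: bit
    by (cases a; cases b) simp_all
  have dist: "hamming_dist x (x + e) = hamming_weight e" if "e \<in> carrier_vec n" for e
  proof -
    have "{i. i < dim_vec x \<and> x $ i \<noteq> (x + e) $ i} = {i. i < dim_vec e \<and> e $ i \<noteq> 0}"
      using assms that diff by auto
    then show ?thesis by (simp only: hamming_dist_def hamming_weight_def)
  qed
  have dist': "hamming_weight (x + y) = hamming_dist x y" if "y \<in> carrier_vec n" for y
    using dist[of "x + y"] inv[OF that] assms that by simp
  show ?thesis
    by (rule bij_betw_byWitness[where f' = "\<lambda>y. x + y"])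
      (use assms in \<open>auto simp: inv dist dist' hamming_ball_def\<close>)
qed

lemma card_hamming_ball:
  assumes "x \<in> carrier_vec n"
  shows "real (card (hamming_ball n x t)) = ball_character_sum n (0\<^sub>v n) t"
proof -
  have "ball_character_sum n (0\<^sub>v n) t = real (card {e \<in> carrier_vec n. hamming_weight e \<le> t})"
    by (simp add: ball_character_sum_def)
  then show ?thesis using bij_betw_same_card[OF hamming_ball_translate[OF assms]] by simp
qed

text \<open>Moving H across the scalar product gives v . (H y); by orthogonality the sum over v then
  detects whether H y = 0.\<close>

lemma indicator_mat_kernel:
  assumes H: "H \<in> carrier_mat m n" and y: "y \<in> carrier_vec n"
  shows "(\<Sum>v\<in>carrier_vec m. bit_sign ((transpose_mat H *\<^sub>v v) \<bullet> y))
    = 2 ^ m * indicator (mat_kernel H) y"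
proof -
  have "(\<Sum>v\<in>carrier_vec m. bit_sign ((transpose_mat H *\<^sub>v v) \<bullet> y))
      = (\<Sum>v\<in>carrier_vec m. bit_sign (v \<bullet> (H *\<^sub>v y)))"
    using H y by (intro sum.cong) (auto simp: transpose_vec_mult_scalar)
  also have "\<dots> = 2 ^ m * indicator (mat_kernel H) y"
    using H y by (subst character_sum') (auto simp: mat_kernel[OF H] indicator_def)
  finally show ?thesis .
qed

text \<open>A form of Poisson summation. With ball points written as x + e, each character factors
  into its values at x and e, and exchanging the sums leaves the indicator of the kernel.\<close>

lemma code_points_in_ball:
  assumes H: "H \<in> carrier_mat m n" and x: "x \<in> carrier_vec n"
  shows "2 ^ m * (\<Sum>z\<in>mat_kernel H. indicator (hamming_ball n x t) z) =
    (\<Sum>v\<in>carrier_vec m. bit_sign ((transpose_mat H *\<^sub>v v) \<bullet> x)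
       * ball_character_sum n (transpose_mat H *\<^sub>v v) t)"
proof -
  let ?u = "\<lambda>v. transpose_mat H *\<^sub>v v"
  let ?E = "{e \<in> carrier_vec n. hamming_weight e \<le> t}"
  have u: "?u v \<in> carrier_vec n" if "v \<in> carrier_vec m" for v
    using H that by auto
  have ball: "hamming_ball n x t \<subseteq> carrier_vec n" and ker: "mat_kernel H \<subseteq> carrier_vec n"
    using mat_kernel_carrier[OF H] by (auto simp: hamming_ball_def)
  then have fin: "finite (hamming_ball n x t)" "finite (mat_kernel H)"
    using finite_subset[OF _ finite_carrier_vec_bit] by auto
  have "(\<Sum>v\<in>carrier_vec m. bit_sign (?u v \<bullet> x) * ball_character_sum n (?u v) t)
      = (\<Sum>v\<in>carrier_vec m. \<Sum>e\<in>?E. bit_sign (?u v \<bullet> (x + e)))"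
    unfolding ball_character_sum_def sum_distrib_left
    by (intro sum.cong refl)
      (use x u in \<open>auto simp: scalar_prod_add_distrib[of _ n] bit_sign_add\<close>)
  also have "\<dots> = (\<Sum>e\<in>?E. \<Sum>v\<in>carrier_vec m. bit_sign (?u v \<bullet> (x + e)))"
    by (rule sum.swap)
  also have "\<dots> = (\<Sum>e\<in>?E. 2 ^ m * indicator (mat_kernel H) (x + e))"
    by (intro sum.cong refl indicator_mat_kernel[OF H]) (use x in auto)
  also have "\<dots> = (\<Sum>y\<in>hamming_ball n x t. 2 ^ m * indicator (mat_kernel H) y)"
    by (rule sum.reindex_bij_betw[OF hamming_ball_translate[OF x]])
  also have "\<dots> = 2 ^ m * (\<Sum>z\<in>mat_kernel H. indicator (hamming_ball n x t) z)"
    using fin by (simp add: sum_distrib_left[symmetric] indicator_def of_bool_def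
        flip: sum.inter_restrict sum.inter_filter) (simp add: Int_commute)
  finally show ?thesis ..
qed

section \<open>The Hamming code\<close>

text \<open>The columns are 2^m - 1 many and cover a set of that size, so none is repeated.\<close>

lemma hamming_parity_check_bij:
  assumes "hamming_parity_check m H"
  shows "bij_betw (col H) {..<2 ^ m - 1} (carrier_vec m - {0\<^sub>v m})"
proof -
  have H: "H \<in> carrier_mat m (2 ^ m - 1)" and cols: "set (cols H) = carrier_vec m - {0\<^sub>v m}"
    using assms by (auto simp: hamming_parity_check_def)
  have "col H ` {..<2 ^ m - 1} = carrier_vec m - {0\<^sub>v m}"
    using H cols by (auto simp: cols_def lessThan_atLeast0)
  moreover have "card (carrier_vec m - {0\<^sub>v m} :: bit vec set) = 2 ^ m - 1"
    by (simp add: card_carrier_vec_bit)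
  ultimately show ?thesis
    by (simp add: bij_betw_def eq_card_imp_inj_on)
qed

text \<open>The entries of H^T v are the products h . v for h running over the nonzero vectors. The
  character sum over all h is 0, so leaving out h = 0 subtracts 1. These words form the simplex
  code, dual to the Hamming code.\<close>

lemma dual_hamming_balanced:
  assumes H: "hamming_parity_check m H" and v: "v \<in> carrier_vec m" "v \<noteq> 0\<^sub>v m"
  shows "(\<Sum>i<2 ^ m - 1. bit_sign ((transpose_mat H *\<^sub>v v) $ i)) = -1"
proof -
  have dim: "H \<in> carrier_mat m (2 ^ m - 1)"
    using H by (simp add: hamming_parity_check_def)
  have "(\<Sum>i<2 ^ m - 1. bit_sign ((transpose_mat H *\<^sub>v v) $ i))
      = (\<Sum>i<2 ^ m - 1. bit_sign (col H i \<bullet> v))"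
    using dim by (intro sum.cong) auto
  also have "\<dots> = (\<Sum>h\<in>carrier_vec m - {0\<^sub>v m}. bit_sign (h \<bullet> v))"
    by (rule sum.reindex_bij_betw[OF hamming_parity_check_bij[OF H]])
  also have "\<dots> = (\<Sum>h\<in>carrier_vec m. bit_sign (h \<bullet> v)) - bit_sign (0\<^sub>v m \<bullet> v)"
    by (simp add: sum_diff1)
  also have "\<dots> = -1"
    using v by (simp add: character_sum')
  finally show ?thesis .
qed

text \<open>The zero word would have the nonnegative sign sum 2^m - 1 instead of -1.\<close>

lemma dual_hamming_nonzero:
  assumes H: "hamming_parity_check m H" and v: "v \<in> carrier_vec m" "v \<noteq> 0\<^sub>v m"
  shows "transpose_mat H *\<^sub>v v \<noteq> 0\<^sub>v (2 ^ m - 1)"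
proof
  assume "transpose_mat H *\<^sub>v v = 0\<^sub>v (2 ^ m - 1)"
  then have "real (2 ^ m - 1) = -1"
    using dual_hamming_balanced[OF assms] by simp
  then show False
    using of_nat_0_le_iff[of "2 ^ m - 1", where 'a = real] by linarith
qed

lemma transpose_mult_zero:
  "(H :: bit mat) \<in> carrier_mat m n \<Longrightarrow> transpose_mat H *\<^sub>v 0\<^sub>v m = 0\<^sub>v n"
  by (intro eq_vecI) auto

text \<open>Double counting replaces rank and nullity: summing the kernel indicator over all words
  and exchanging sums, only v = 0 survives, because H^T v is nonzero for every other v.\<close>

lemma card_hamming_code:
  assumes H: "hamming_parity_check m H"
  shows "2 ^ m * real (card (mat_kernel H)) = 2 ^ (2 ^ m - 1)"
proof -
  let ?n = "2 ^ m - 1 :: nat"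
  have dim: "H \<in> carrier_mat m ?n"
    using H by (simp add: hamming_parity_check_def)
  have u: "transpose_mat H *\<^sub>v v \<in> carrier_vec ?n" if "v \<in> carrier_vec m" for v
    using dim that by auto
  have "2 ^ m * real (card (mat_kernel H)) = (\<Sum>y\<in>carrier_vec ?n. 2 ^ m * indicator (mat_kernel H) y)"
    using mat_kernel_carrier[OF dim]
    by (simp add: sum_distrib_left[symmetric] sum_indicator_subset)
  also have "\<dots> = (\<Sum>y\<in>carrier_vec ?n. \<Sum>v\<in>carrier_vec m. bit_sign ((transpose_mat H *\<^sub>v v) \<bullet> y))"
    by (rule sum.cong) (simp_all add: indicator_mat_kernel[OF dim])
  also have "\<dots> = (\<Sum>v\<in>carrier_vec m. \<Sum>y\<in>carrier_vec ?n. bit_sign ((transpose_mat H *\<^sub>v v) \<bullet> y))"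
    by (rule sum.swap)
  also have "\<dots> = (\<Sum>v\<in>(carrier_vec m :: bit vec set). if v = 0\<^sub>v m then 2 ^ ?n else 0)"
    by (rule sum.cong)
      (use u dual_hamming_nonzero[OF H] transpose_mult_zero[OF dim] in \<open>auto simp: character_sum\<close>)
  also have "\<dots> = 2 ^ ?n" by simp
  finally show ?thesis .
qed

section \<open>Discrepancy of the Hamming code\<close>

lemma local_discrepancy_hamming_code:
  assumes H: "hamming_parity_check m H" and k: "2 ^ m - 1 = 2 * k + 1"
    and x: "x \<in> carrier_vec (2 * k + 1)"
  shows "1 / real (card (mat_kernel H)) * (\<Sum>z\<in>mat_kernel H. indicator (hamming_ball (2 * k + 1) x t) z)
      - real (card (hamming_ball (2 * k + 1) x t)) / 2 ^ (2 * k + 1)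
    = coeff ([:1, 0, -1:] ^ k) t / 2 ^ (2 * k + 1) * (2 ^ m * indicator (mat_kernel H) x - 1)"
proof -
  let ?n = "2 * k + 1" and ?N = "real (card (mat_kernel H))"
  let ?u = "\<lambda>v. transpose_mat H *\<^sub>v v" and ?c = "coeff ([:1, 0, -1:] ^ k) t :: real"
  let ?S = "\<Sum>z\<in>mat_kernel H. indicator (hamming_ball ?n x t) z :: real"
  have dim: "H \<in> carrier_mat m ?n"
    using H k by (simp add: hamming_parity_check_def)
  have split: "(\<Sum>v\<in>carrier_vec m. f v) = f (0\<^sub>v m) + (\<Sum>v\<in>carrier_vec m - {0\<^sub>v m}. f v)"
    for f :: "bit vec \<Rightarrow> real"
    by (rule sum.remove) auto
  have ind: "(\<Sum>v\<in>carrier_vec m - {0\<^sub>v m}. bit_sign (?u v \<bullet> x)) = 2 ^ m * indicator (mat_kernel H) x - 1"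
    using indicator_mat_kernel[OF dim x] x
    by (simp add: split transpose_mult_zero[OF dim])
  have "2 ^ m * ?S = (\<Sum>v\<in>carrier_vec m. bit_sign (?u v \<bullet> x) * ball_character_sum ?n (?u v) t)"
    by (rule code_points_in_ball[OF dim x])
  \<comment> \<open>The term v = 0 is the ball's cardinality; after division by 2^n it cancels the
    expected proportion of points.\<close>
  also have "\<dots> = real (card (hamming_ball ?n x t))
      + (\<Sum>v\<in>carrier_vec m - {0\<^sub>v m}. bit_sign (?u v \<bullet> x) * ball_character_sum ?n (?u v) t)"
    using x by (simp add: split transpose_mult_zero[OF dim] card_hamming_ball)
  \<comment> \<open>Balancedness of H^T v makes the ball sum independent of v, so it factors out and
    \<open>ind\<close> evaluates the rest.\<close>
  also have "(\<Sum>v\<in>carrier_vec m - {0\<^sub>v m}. bit_sign (?u v \<bullet> x) * ball_character_sum ?n (?u v) t)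
      = (\<Sum>v\<in>carrier_vec m - {0\<^sub>v m}. bit_sign (?u v \<bullet> x) * ?c)"
  proof (rule sum.cong[OF refl])
    fix v :: "bit vec" assume "v \<in> carrier_vec m - {0\<^sub>v m}"
    then have "(\<Sum>i<?n. bit_sign (?u v $ i)) = -1"
      using dual_hamming_balanced[OF H] k by simp
    then show "bit_sign (?u v \<bullet> x) * ball_character_sum ?n (?u v) t = bit_sign (?u v \<bullet> x) * ?c"
      by (simp only: ball_character_sum_balanced)
  qed
  also have "\<dots> = ?c * (2 ^ m * indicator (mat_kernel H) x - 1)"
    by (simp only: sum_distrib_right[symmetric] ind mult.commute)
  finally have S: "2 ^ m * ?S = real (card (hamming_ball ?n x t))
      + ?c * (2 ^ m * indicator (mat_kernel H) x - 1)" .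
  have N: "2 ^ m * ?N = 2 ^ ?n"
    using card_hamming_code[OF H] k by simp
  have "1 / ?N * ?S = (2 ^ m * ?S) / (2 ^ m * ?N)"
    by simp
  also have "\<dots> = real (card (hamming_ball ?n x t)) / 2 ^ ?n
      + ?c / 2 ^ ?n * (2 ^ m * indicator (mat_kernel H) x - 1)"
    unfolding S N by (simp add: add_divide_distrib)
  finally show ?thesis by simp
qed

lemma L2_discrepancy_hamming_code:
  assumes C: "is_hamming_code m C" and k: "2 ^ m - 1 = 2 * k + 1"
  shows "L2_discrepancy (2 * k + 1) C
    = real (2 * k + 1) / 2 ^ (2 * k + 1) * real ((2 * k) choose k)"
proof -
  let ?n = "2 * k + 1"
  obtain H where H: "hamming_parity_check m H" and CH: "C = mat_kernel H"
    using C by (auto simp: is_hamming_code_def)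
  have dim: "H \<in> carrier_mat m ?n"
    using H k by (simp add: hamming_parity_check_def)
  have N: "2 ^ m * real (card C) = 2 ^ ?n"
    using card_hamming_code[OF H] k by (simp add: CH)
  have "real (2 ^ m) = real (?n + 1)"
    using k by (intro arg_cong[where f = real]) linarith
  then have m: "2 ^ m = real ?n + 1" by simp
  \<comment> \<open>The indicator is idempotent, so with a = 2^m the square is (a - 2) times a times
    the indicator, plus 1. Summation gives (a - 2) + 1 = n copies of 2^n.\<close>
  have "(\<Sum>x\<in>carrier_vec ?n. (2 ^ m * indicator C x - 1 :: real)\<^sup>2)
      = (\<Sum>x\<in>carrier_vec ?n. (2 ^ m - 2) * (2 ^ m * indicator C x) + 1)"
    by (rule sum.cong) (auto simp: indicator_def power2_eq_square algebra_simps)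
  also have "\<dots> = (2 ^ m - 2) * (2 ^ m * real (card C)) + 2 ^ ?n"
    using mat_kernel_carrier[OF dim]
    by (simp add: sum.distrib sum_distrib_left[symmetric] sum_indicator_subset
        card_carrier_vec_bit CH)
  also have "\<dots> = real ?n * 2 ^ ?n"
    by (simp only: N) (simp add: m algebra_simps)
  finally have square: "(\<Sum>x\<in>carrier_vec ?n. (2 ^ m * indicator C x - 1 :: real)\<^sup>2) = real ?n * 2 ^ ?n" .
  have "L2_discrepancy ?n C = (\<Sum>t = 0..?n. \<Sum>x\<in>carrier_vec ?n.
      (coeff ([:1, 0, -1:] ^ k) t / 2 ^ ?n * (2 ^ m * indicator C x - 1))\<^sup>2)"
    unfolding L2_discrepancy_def CH
    by (intro sum.cong refl arg_cong[where f = "\<lambda>r. r\<^sup>2"] local_discrepancy_hamming_code[OF H k])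
  also have "\<dots> = (\<Sum>t = 0..?n. (coeff ([:1, 0, -1:] ^ k) t)\<^sup>2 / (2 ^ ?n)\<^sup>2 * (real ?n * 2 ^ ?n))"
    by (simp only: power_mult_distrib power_divide sum_distrib_left[symmetric] square)
  also have "\<dots> = (\<Sum>t = 0..?n. (coeff ([:1, 0, -1:] ^ k) t)\<^sup>2) * (real ?n / 2 ^ ?n)"
    unfolding sum_distrib_right by (rule sum.cong) (simp_all add: power2_eq_square field_simps)
  also have "\<dots> = real ?n / 2 ^ ?n * real ((2 * k) choose k)"
    unfolding sum_squares_coeff_one_minus_square_power by (rule mult.commute)
  finally show ?thesis .
qed

section \<open>Asymptotics\<close>

text \<open>Partial product of Wallis' formula, with limit pi / 2.\<close>

definition wallis_product :: "nat \<Rightarrow> real" where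
  "wallis_product k = (\<Prod>j = 1..k. (4 * real j ^ 2) / (4 * real j ^ 2 - 1))"

text \<open>By induction: the new Wallis factor 4(k+1)^2 / ((2k+1)(2k+3)) cancels the growth
  4(2k+1)(2k+3) / (k+1)^2 of the other factor up to 16, the growth of the right-hand side.\<close>

lemma wallis_product_central_binomial:
  "wallis_product k * ((2 * real k + 1) * (real ((2 * k) choose k))\<^sup>2) = (4 ^ k)\<^sup>2"
proof (induction k)
  case 0
  show ?case by (simp add: wallis_product_def)
next
  case (Suc k)
  let ?b = "real ((2 * k) choose k)" and ?r = "real k"
  have b: "real ((2 * Suc k) choose Suc k) = 2 * (2 * ?r + 1) * ?b / (?r + 1)"
  proof -
    have "real ((2 * Suc k) choose Suc k) = fact (2 * Suc k) / (fact (Suc k) * fact (2 * Suc k - Suc k))"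
      by (rule binomial_fact) simp
    also have "fact (2 * Suc k) = 2 * (?r + 1) * (2 * ?r + 1) * (fact (2 * k) :: real)"
      by (simp add: algebra_simps)
    also have "fact (Suc k) * fact (2 * Suc k - Suc k) = (?r + 1)\<^sup>2 * (fact k * fact k)"
      by (simp add: power2_eq_square algebra_simps)
    also have "2 * (?r + 1) * (2 * ?r + 1) * fact (2 * k) / ((?r + 1)\<^sup>2 * (fact k * fact k))
        = 2 * (2 * ?r + 1) * (fact (2 * k) / (fact k * fact k)) / (?r + 1)"
      by (simp add: power2_eq_square divide_simps) (simp add: algebra_simps)
    also have "fact (2 * k) / (fact k * fact k) = ?b"
      using binomial_fact[of k "2 * k", where 'a = real] by simp
    finally show ?thesis .
  qed
  have W: "wallis_product (Suc k) = wallis_product k * (4 * (?r + 1)\<^sup>2 / ((2 * ?r + 1) * (2 * ?r + 3)))"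
    by (simp add: wallis_product_def power2_eq_square algebra_simps)
  have "wallis_product (Suc k) * ((2 * real (Suc k) + 1) * (real ((2 * Suc k) choose Suc k))\<^sup>2)
      = wallis_product k * (4 * (?r + 1)\<^sup>2 / ((2 * ?r + 1) * (2 * ?r + 3)))
          * ((2 * ?r + 3) * (2 * (2 * ?r + 1) * ?b / (?r + 1))\<^sup>2)"
    unfolding W b by (simp add: add.commute)
  also have "\<dots> = 16 * (wallis_product k * ((2 * ?r + 1) * ?b\<^sup>2))"
    by (simp add: divide_simps power2_eq_square) (simp add: algebra_simps)
  finally show ?case using Suc.IH by (simp add: power2_eq_square)
qed

text \<open>For n = 2k + 1, \<open>n div 2\<close> is k and the relative error is exact. Even n are
  not lengths of the codes considered; the value 0 there keeps the limit.\<close>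

definition hamming_error :: "nat \<Rightarrow> real" where
  "hamming_error n = (if odd n then 1 - sqrt (pi / 2 / wallis_product (n div 2)) else 0)"

lemma hamming_error_tendsto_0: "hamming_error \<longlonglongrightarrow> 0"
proof -
  have "filterlim (\<lambda>n::nat. n div 2) at_top at_top"
    unfolding filterlim_at_top
  proof
    fix Z :: nat
    show "\<forall>\<^sub>F n in at_top. Z \<le> n div 2"
      using eventually_ge_at_top[of "2 * Z"] by eventually_elim simp
  qed
  then have "(\<lambda>n. wallis_product (n div 2)) \<longlonglongrightarrow> pi / 2"
    using filterlim_compose[OF wallis] unfolding wallis_product_def by blast
  then have "(\<lambda>n. 1 - sqrt (pi / 2 / wallis_product (n div 2))) \<longlonglongrightarrow> 1 - sqrt (pi / 2 / (pi / 2))"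
    by (intro tendsto_intros) auto
  then have lim: "(\<lambda>n. 1 - sqrt (pi / 2 / wallis_product (n div 2))) \<longlonglongrightarrow> 0"
    by simp
  show ?thesis
    \<comment> \<open>Comparison of absolute values: equality at odd n, and 0 on the left at even
      n.\<close>
    by (rule Lim_null_comparison[OF _ tendsto_norm_zero[OF lim]])
      (simp add: hamming_error_def)
qed

text \<open>The Wallis identity is solved for \<open>wallis_product k\<close>. Then pi cancels under
  the root, leaving a perfect square, and 2 * 4^k = 2^(2k+1).\<close>

lemma central_binomial_wallis_sqrt:
  "real (2 * k + 1) / 2 ^ (2 * k + 1) * real ((2 * k) choose k)
    = sqrt (real (2 * k + 1) / (2 * pi)) * sqrt (pi / 2 / wallis_product k)"
proof -
  let ?r = "real (2 * k + 1)" and ?b = "real ((2 * k) choose k)"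
  have W: "wallis_product k = (4 ^ k)\<^sup>2 / (?r * ?b\<^sup>2)"
    using wallis_product_central_binomial[of k]
    by (subst eq_divide_eq) (simp_all add: add_ac)
  have "sqrt (?r / (2 * pi)) * sqrt (pi / 2 / wallis_product k) = sqrt ((?r * ?b / (2 * 4 ^ k))\<^sup>2)"
    unfolding W real_sqrt_mult[symmetric] by (simp add: field_simps power2_eq_square)
  also have "\<dots> = ?r * ?b / (2 * 4 ^ k)"
    by (simp add: abs_of_nonneg)
  also have "\<dots> = ?r / 2 ^ (2 * k + 1) * ?b"
    by (simp add: power_mult)
  finally show ?thesis ..
qed

theorem theorem3p6:
  shows "(\<forall>(m::nat) (n::nat) C. m \<ge> 2 \<and> n = 2 ^ m - 1 \<and> is_hamming_code m C \<longrightarrow>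
            L2_discrepancy n C = real n / 2 ^ n * real ((n - 1) choose ((n - 1) div 2))) \<and>
         (\<exists>\<epsilon> :: nat \<Rightarrow> real. \<epsilon> \<in> o[at_top](\<lambda>_. 1) \<and>
            (\<forall>\<^sub>F n in at_top. \<forall>(m::nat) C. m \<ge> 2 \<and> n = 2 ^ m - 1 \<and> is_hamming_code m C \<longrightarrow>
               L2_discrepancy n C = sqrt (real n / (2 * pi)) * (1 - \<epsilon> n)))"
proof (intro conjI exI[of _ hamming_error])
  have odd_length: "\<exists>k. n = 2 * k + 1" if "m \<ge> 2" "n = 2 ^ m - 1" for m n :: nat
  proof -
    have "odd n" using that by simp
    then show ?thesis by (rule oddE) blast
  qed
  show "\<forall>(m::nat) (n::nat) C. m \<ge> 2 \<and> n = 2 ^ m - 1 \<and> is_hamming_code m C \<longrightarrow>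
      L2_discrepancy n C = real n / 2 ^ n * real ((n - 1) choose ((n - 1) div 2))"
  proof (intro allI impI, elim conjE)
    fix m n :: nat and C
    assume *: "m \<ge> 2" "n = 2 ^ m - 1" "is_hamming_code m C"
    then obtain k where k: "n = 2 * k + 1" using odd_length by blast
    then show "L2_discrepancy n C = real n / 2 ^ n * real ((n - 1) choose ((n - 1) div 2))"
      using L2_discrepancy_hamming_code[OF *(3), of k] *(2) by simp
  qed
  show "hamming_error \<in> o[at_top](\<lambda>_. 1)"
    using hamming_error_tendsto_0 by (intro smalloI_tendsto) simp_all
  show "\<forall>\<^sub>F n in at_top. \<forall>(m::nat) C. m \<ge> 2 \<and> n = 2 ^ m - 1 \<and> is_hamming_code m C \<longrightarrow>
      L2_discrepancy n C = sqrt (real n / (2 * pi)) * (1 - hamming_error n)"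
  \<comment> \<open>\<open>hamming_error\<close> makes the formula an identity at each code length,
    so it holds for all n.\<close>
  proof (intro always_eventually allI impI, elim conjE)
    fix m n :: nat and C
    assume *: "m \<ge> 2" "n = 2 ^ m - 1" "is_hamming_code m C"
    then obtain k where k: "n = 2 * k + 1" using odd_length by blast
    then have "L2_discrepancy n C = real n / 2 ^ n * real ((2 * k) choose k)"
      using L2_discrepancy_hamming_code[OF *(3), of k] *(2) by simp
    also have "\<dots> = sqrt (real n / (2 * pi)) * (1 - hamming_error n)"
      unfolding k central_binomial_wallis_sqrt by (simp add: hamming_error_def)
    finally show "L2_discrepancy n C = sqrt (real n / (2 * pi)) * (1 - hamming_error n)" .
  qed
qed

end
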